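(* Let $\rho>0$. For all $x\in\mathbb{R}^n$ with nonnegative entries and $\|x\|_2\le\sqrt{\frac2\rho}$, it holds that $0\in\mathrm{prox}_{\frac1\rho h_1}(x)$.
   Context: $h_1(u)=\|u\|_1/\|u\|_2$ for $u\in\mathbb{R}^n\setminus\{0\}$ and $h_1(0)=0$. $\mathrm{prox}_{\frac1\rho h_1}(x)$ is the set of all minimizers over $u\in\mathbb{R}^n$ of $\frac{\rho}{2}\|u-x\|_2^2+h_1(u)$. *)

theory Defs
  imports "HOL-Analysis.Analysis"
begin

definition norm1 :: "real ^ 'n \<Rightarrow> real" where
  "norm1 u = (\<Sum>i\<in>UNIV. \<bar>u $ i\<bar>)"

definition h1 :: "real ^ 'n \<Rightarrow> real" where
  "h1 u = (if u = 0 then 0 else norm1 u / norm u)"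

text \<open>The (set-valued) proximal operator of \<open>f / \<rho>\<close>, in its form scaled by \<open>\<rho>\<close>:
  the minimizers of \<open>\<rho> / 2 * \<parallel>u - x\<parallel>\<^sup>2 + f u\<close> over the whole space.\<close>

definition prox :: "real \<Rightarrow> (real ^ 'n \<Rightarrow> real) \<Rightarrow> real ^ 'n \<Rightarrow> (real ^ 'n) set" where
  "prox \<rho> f x = {u. is_arg_min (\<lambda>u. \<rho> / 2 * (norm (u - x))\<^sup>2 + f u) (\<lambda>u. True) u}"

end

theory Submission
  imports Defs
begin

text \<open>
  Since \<open>\<parallel>u\<parallel>\<^sub>1 \<ge> \<parallel>u\<parallel>\<close>, we have \<open>h1 u \<ge> 1\<close> for \<open>u \<noteq> 0\<close>. With \<open>c = sqrt (\<rho> / 2)\<close> the hypothesis reads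
  \<open>c * \<parallel>x\<parallel> \<le> 1\<close>, so by Cauchy-Schwarz the objective at \<open>u \<noteq> 0\<close> exceeds its value at \<open>0\<close> by
  at least \<open>(c * \<parallel>u\<parallel>)\<^sup>2 - 2 * c * \<parallel>u\<parallel> + 1 = (c * \<parallel>u\<parallel> - 1)\<^sup>2 \<ge> 0\<close>.
\<close>

lemma h1_ge_1:
  assumes "u \<noteq> 0"
  shows "h1 u \<ge> 1"
  using assms norm_le_l1_cart[of u] by (simp add: h1_def norm1_def)

theorem theorem4p3:
  fixes \<rho> :: real and x :: "real ^ 'n"
  assumes "\<rho> > 0"
    and "\<And>i. x $ i \<ge> 0"
    and "norm x \<le> sqrt (2 / \<rho>)"
  shows "0 \<in> prox \<rho> h1 x"
proof -
  define c where "c = sqrt (\<rho> / 2)"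
  have c: "c > 0" and \<rho>: "\<rho> = 2 * c\<^sup>2"
    using assms(1) by (auto simp: c_def)
  have "c * norm x \<le> c * sqrt (2 / \<rho>)"
    using assms(3) c by simp
  also have "\<dots> = 1"
    using assms(1) by (simp add: c_def flip: real_sqrt_mult)
  finally have cx: "c * norm x \<le> 1" .
  have "\<rho> / 2 * (norm (0 - x))\<^sup>2 + h1 (0 :: real ^ 'n) \<le> \<rho> / 2 * (norm (u - x))\<^sup>2 + h1 u" for u :: "real ^ 'n"
  proof (cases "u = 0")
    case False
    have "c\<^sup>2 * (u \<bullet> x) \<le> c\<^sup>2 * (norm u * norm x)"
      by (intro mult_left_mono norm_cauchy_schwarz) simp
    \<comment> \<open>One factor \<open>c\<close> goes to each norm, so that \<open>cx\<close>
      applies to the second product.\<close>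
    also have "\<dots> = c * norm u * (c * norm x)"
      by (simp add: power2_eq_square)
    also have "\<dots> \<le> c * norm u"
      using mult_left_mono[OF cx, of "c * norm u"] c by simp
    finally have "c\<^sup>2 * (u \<bullet> x) \<le> c * norm u" .
    moreover have "c\<^sup>2 * (norm (u - x))\<^sup>2 = (c * norm u)\<^sup>2 - 2 * (c\<^sup>2 * (u \<bullet> x)) + c\<^sup>2 * (norm x)\<^sup>2"
      by (simp add: power_mult_distrib power2_norm_eq_inner inner_diff inner_commute algebra_simps)
    moreover have "(c * norm u)\<^sup>2 - 2 * (c * norm u) + 1 \<ge> 0"
      using zero_le_power2[of "c * norm u - 1"] by (simp add: power2_diff)
    \<comment> \<open>The terms \<open>c\<^sup>2 * (norm x)\<^sup>2\<close> cancel, and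
      \<open>h1 u \<ge> 1\<close> supplies the 1 that completes the square. Only \<open>h1 0\<close>
      is unfolded, to its default value 0.\<close>
    ultimately show ?thesis
      using h1_ge_1[OF False] by (simp add: \<rho> h1_def[of 0])
  qed simp
  \<comment> \<open>\<open>is_arg_min\<close> only excludes strictly smaller values; linearity of
    the order makes this the bound just shown.\<close>
  then show ?thesis
    by (simp add: prox_def is_arg_min_linorder)
qed

end
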